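(* Let $E_1\subseteq V_1\times W_1$ and $E_2\subseteq V_2\times W_2$ be hypergraphs. Then: (i) $E_1\to_{\rm loc}E_2$ if and only if there exists a homomorphism from $E_1$ to $E_2$; (ii) if $V_1=V_2$ and $W_1=W_2$, then $E_1\simeq_{\rm loc}E_2$ if and only if the hypergraphs $E_1$ and $E_2$ are isomorphic.
   Context: A hypergraph is a subset $E\subseteq V\times W$ with $V,W$ finite sets; for $w\in W$, $E(w)=\{v\in V:(v,w)\in E\}$, and the edges of $E$ are the sets $E(w)$, $w\in W$. A map $f:V_2\to V_1$ is a homomorphism from $E_1$ to $E_2$ if $f^{-1}(\alpha)$ is an edge of $E_2$ whenever $\alpha$ is an edge of $E_1$; equivalently, if there is $g:W_1\to W_2$ with $f^{-1}(E_1(w_1))=E_2(g(w_1))$ for all $w_1\in W_1$. If $V_1=V_2$ and $W_1=W_2$, an isomorphism from $E_1$ to $E_2$ is a bijective homomorphism $f$ for which such a $g$ can be chosen to be a bijection; $E_1,E_2$ are isomorphic if one exists. $\mathcal D_V$ is the algebra of complex diagonal $V\times V$ matrices with diagonal matrix units $\epsilon_{v,v}$; a channel $\mathcal D_V\to\mathcal D_W$ is a positive trace-preserving linear map $\mathcal E$, and $\mathcal E(w|v)$ is the $(w,w)$ entry of $\mathcal E(\epsilon_{v,v})$. A local correlation over $(V_2,W_1,V_1,W_2)$ is a convex combination $\Gamma:\mathcal D_{V_2\times W_1}\to\mathcal D_{V_1\times W_2}$ of $\Phi\otimes\Psi$ with channels $\Phi:\mathcal D_{V_2}\to\mathcal D_{V_1}$,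 $\Psi:\mathcal D_{W_1}\to\mathcal D_{W_2}$. If $V_1=V_2$, $W_1=W_2$, a local bicorrelation is a convex combination of correlations $p^{(1)}(v_1|v_2)p^{(2)}(w_2|w_1)$ with $(p^{(1)}(v_1|v_2))$, $(p^{(2)}(w_2|w_1))$ scalar bistochastic matrices. $\Gamma$ fits $E_1\leftrightarrow E_2$ if $\Gamma(v_1,w_2|v_2,w_1)\ne0$ implies $[(v_1,w_1)\in E_1\Leftrightarrow(v_2,w_2)\in E_2]$. $E_1\to_{\rm loc}E_2$ means that some local correlation over $(V_2,W_1,V_1,W_2)$ fits $E_1\leftrightarrow E_2$; $E_1\simeq_{\rm loc}E_2$ (for $V_1=V_2$, $W_1=W_2$) means that some local bicorrelation fits $E_1\leftrightarrow E_2$. *)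

theory Defs
  imports "HOL-Analysis.Analysis"
begin

section \<open>Hypergraphs\<close>

definition hypergraph :: "'v set \<Rightarrow> 'w set \<Rightarrow> ('v \<times> 'w) set \<Rightarrow> bool" where
  "hypergraph V W E \<longleftrightarrow> finite V \<and> finite W \<and> E \<subseteq> V \<times> W"

definition hedge :: "'v set \<Rightarrow> ('v \<times> 'w) set \<Rightarrow> 'w \<Rightarrow> 'v set" where
  "hedge V E w = {v \<in> V. (v, w) \<in> E}"

definition hedges :: "'v set \<Rightarrow> 'w set \<Rightarrow> ('v \<times> 'w) set \<Rightarrow> 'v set set" where
  "hedges V W E = hedge V E ` W"

text \<open>Note the direction: a homomorphism from \<open>E1\<close> to \<open>E2\<close> is a map from \<open>V2\<close> to \<open>V1\<close>.\<close>

definition hypergraph_hom ::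
  "'v set \<Rightarrow> 'w set \<Rightarrow> ('v \<times> 'w) set \<Rightarrow> 'x set \<Rightarrow> 'y set \<Rightarrow> ('x \<times> 'y) set \<Rightarrow> ('x \<Rightarrow> 'v) \<Rightarrow> bool" where
  "hypergraph_hom V1 W1 E1 V2 W2 E2 f \<longleftrightarrow>
     f \<in> V2 \<rightarrow> V1 \<and> (\<forall>\<alpha>\<in>hedges V1 W1 E1. f -` \<alpha> \<inter> V2 \<in> hedges V2 W2 E2)"

definition hypergraph_iso ::
  "'v set \<Rightarrow> 'w set \<Rightarrow> ('v \<times> 'w) set \<Rightarrow> ('v \<times> 'w) set \<Rightarrow> ('v \<Rightarrow> 'v) \<Rightarrow> bool" where
  "hypergraph_iso V W E1 E2 f \<longleftrightarrow>
     hypergraph_hom V W E1 V W E2 f \<and> bij_betw f V V \<and>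
     (\<exists>g. bij_betw g W W \<and> (\<forall>w\<in>W. f -` hedge V E1 w \<inter> V = hedge V E2 (g w)))"

definition isomorphic_hypergraphs ::
  "'v set \<Rightarrow> 'w set \<Rightarrow> ('v \<times> 'w) set \<Rightarrow> ('v \<times> 'w) set \<Rightarrow> bool" where
  "isomorphic_hypergraphs V W E1 E2 \<longleftrightarrow> (\<exists>f. hypergraph_iso V W E1 E2 f)"


section \<open>Diagonal matrix algebras and channels\<close>

text \<open>A \<open>V \<times> V\<close> matrix is a function of two indices that vanishes outside \<open>V \<times> V\<close>.
  Maps between matrix algebras are only constrained on the algebra of diagonal matrices; their
  values elsewhere are irrelevant.\<close>

type_synonym 'a cmat = "'a \<Rightarrow> 'a \<Rightarrow> complex"

definition diag_alg :: "'a set \<Rightarrow> 'a cmat set" where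
  "diag_alg V = {A. \<forall>i j. A i j \<noteq> 0 \<longrightarrow> i \<in> V \<and> j = i}"

definition diag_unit :: "'a \<Rightarrow> 'a cmat" where
  "diag_unit v = (\<lambda>i j. if i = v \<and> j = v then 1 else 0)"

definition ctrace :: "'a set \<Rightarrow> 'a cmat \<Rightarrow> complex" where
  "ctrace V A = (\<Sum>v\<in>V. A v v)"

definition pos_semidef :: "'a set \<Rightarrow> 'a cmat \<Rightarrow> bool" where
  "pos_semidef V A \<longleftrightarrow> (\<forall>x. (\<Sum>i\<in>V. \<Sum>j\<in>V. cnj (x i) * A i j * x j) \<in> \<real>\<^sub>\<ge>\<^sub>0)"

definition channel :: "'a set \<Rightarrow> 'b set \<Rightarrow> ('a cmat \<Rightarrow> 'b cmat) \<Rightarrow> bool" where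
  "channel V W T \<longleftrightarrow>
     T \<in> diag_alg V \<rightarrow> diag_alg W \<and>
     (\<forall>A\<in>diag_alg V. \<forall>B\<in>diag_alg V. T (\<lambda>i j. A i j + B i j) = (\<lambda>i j. T A i j + T B i j)) \<and>
     (\<forall>c. \<forall>A\<in>diag_alg V. T (\<lambda>i j. c * A i j) = (\<lambda>i j. c * T A i j)) \<and>
     (\<forall>A\<in>diag_alg V. pos_semidef V A \<longrightarrow> pos_semidef W (T A)) \<and>
     (\<forall>A\<in>diag_alg V. ctrace W (T A) = ctrace V A)"

text \<open>\<open>channel_prob T w v\<close> is the transition coefficient \<open>T(w|v)\<close>.\<close>

definition channel_prob :: "('a cmat \<Rightarrow> 'b cmat) \<Rightarrow> 'b \<Rightarrow> 'a \<Rightarrow> complex" where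
  "channel_prob T w v = T (diag_unit v) w w"

definition kron :: "'a cmat \<Rightarrow> 'b cmat \<Rightarrow> ('a \<times> 'b) cmat" where
  "kron A B = (\<lambda>p q. A (fst p) (fst q) * B (snd p) (snd q))"

text \<open>The tensor product of linear maps on the algebras of \<open>V\<close> and \<open>W\<close>, given by linear
  extension from the basis of diagonal matrix units of the algebra of \<open>V \<times> W\<close>; see
  \<open>tensor_map_kron\<close> below for the usual characterisation.\<close>

definition tensor_map ::
  "'a set \<Rightarrow> 'b set \<Rightarrow> ('a cmat \<Rightarrow> 'c cmat) \<Rightarrow> ('b cmat \<Rightarrow> 'd cmat) \<Rightarrow>
   ('a \<times> 'b) cmat \<Rightarrow> ('c \<times> 'd) cmat" where
  "tensor_map V W \<Phi> \<Psi> M =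
     (\<lambda>p q. \<Sum>(v, w)\<in>V \<times> W. M (v, w) (v, w) * kron (\<Phi> (diag_unit v)) (\<Psi> (diag_unit w)) p q)"

lemma channel_expand:
  assumes T: "channel V W T" and fin: "finite V" and A: "A \<in> diag_alg V"
  shows "T A i j = (\<Sum>v\<in>V. A v v * T (diag_unit v) i j)"
proof -
  have add: "T (\<lambda>i j. A i j + B i j) = (\<lambda>i j. T A i j + T B i j)"
    if "A \<in> diag_alg V" "B \<in> diag_alg V" for A B
    using T that unfolding channel_def by blast
  have scale: "T (\<lambda>i j. c * A i j) = (\<lambda>i j. c * T A i j)" if "A \<in> diag_alg V" for c A
    using T that unfolding channel_def by blast
  have unit: "diag_unit v \<in> diag_alg V" if "v \<in> V" for v
    using that by (auto simp: diag_alg_def diag_unit_def)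
  have zero: "T (\<lambda>i j. 0) = (\<lambda>i j. 0)"
    using scale[of "\<lambda>i j. 0" 0] by (simp add: diag_alg_def)
  have part: "T (\<lambda>i j. \<Sum>v\<in>F. A v v * diag_unit v i j) =
      (\<lambda>i j. \<Sum>v\<in>F. A v v * T (diag_unit v) i j)" if "finite F" "F \<subseteq> V" for F
    using that
  proof (induction F rule: finite_induct)
    case empty
    show ?case using zero by simp
  next
    case (insert x F)
    have 1: "(\<lambda>i j. A x x * diag_unit x i j) \<in> diag_alg V"
      using insert.prems by (auto simp: diag_alg_def diag_unit_def)
    have 2: "(\<lambda>i j. \<Sum>v\<in>F. A v v * diag_unit v i j) \<in> diag_alg V"
    proof -
      have "i \<in> V \<and> j = i" if nz: "(\<Sum>v\<in>F. A v v * diag_unit v i j) \<noteq> 0" for i j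
      proof -
        obtain v where "v \<in> F" "A v v * diag_unit v i j \<noteq> 0"
          using sum.not_neutral_contains_not_neutral[OF nz] by blast
        then show ?thesis
          using insert.prems by (auto simp: diag_unit_def split: if_splits)
      qed
      then show ?thesis by (simp add: diag_alg_def)
    qed
    show ?case
      using insert add[OF 1 2] scale[OF unit, of x "A x x"] by simp
  qed
  have "A = (\<lambda>i j. \<Sum>v\<in>V. A v v * diag_unit v i j)"
  proof (intro ext)
    fix i j
    have "(\<Sum>v\<in>V. A v v * diag_unit v i j) = (\<Sum>v\<in>V. if i = v then (if j = i then A i i else 0) else 0)"
      by (intro sum.cong) (auto simp: diag_unit_def)
    also have "\<dots> = A i j"
      using A fin by (auto simp: diag_alg_def)
    finally show "A i j = (\<Sum>v\<in>V. A v v * diag_unit v i j)" ..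
  qed
  then show ?thesis
    using part[OF fin order_refl] by metis
qed

lemma tensor_map_kron:
  assumes "channel V V' \<Phi>" "channel W W' \<Psi>" "finite V" "finite W"
    and "A \<in> diag_alg V" "B \<in> diag_alg W"
  shows "tensor_map V W \<Phi> \<Psi> (kron A B) = kron (\<Phi> A) (\<Psi> B)"
  using assms
  by (intro ext)
     (simp add: tensor_map_def kron_def channel_expand[of V V' \<Phi> A] channel_expand[of W W' \<Psi> B]
        sum_product sum.cartesian_product case_prod_unfold mult_ac)


section \<open>Local correlations and bicorrelations\<close>

definition local_correlation ::
  "'a set \<Rightarrow> 'b set \<Rightarrow> 'c set \<Rightarrow> 'd set \<Rightarrow> (('a \<times> 'b) cmat \<Rightarrow> ('c \<times> 'd) cmat) \<Rightarrow> bool" where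
  "local_correlation V2 W1 V1 W2 \<Gamma> \<longleftrightarrow>
     (\<exists>(n::nat) (c :: nat \<Rightarrow> real) \<Phi> \<Psi>.
        (\<forall>k<n. 0 \<le> c k) \<and> (\<Sum>k<n. c k) = 1 \<and>
        (\<forall>k<n. channel V2 V1 (\<Phi> k) \<and> channel W1 W2 (\<Psi> k)) \<and>
        (\<forall>M\<in>diag_alg (V2 \<times> W1).
           \<Gamma> M = (\<lambda>p q. \<Sum>k<n. of_real (c k) * tensor_map V2 W1 (\<Phi> k) (\<Psi> k) M p q)))"

text \<open>Scalar bistochastic matrices; \<open>p x y\<close> stands for \<open>p(x|y)\<close>.\<close>

definition bistochastic :: "'a set \<Rightarrow> ('a \<Rightarrow> 'a \<Rightarrow> real) \<Rightarrow> bool" where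
  "bistochastic V p \<longleftrightarrow>
     (\<forall>x\<in>V. \<forall>y\<in>V. 0 \<le> p x y) \<and>
     (\<forall>y\<in>V. (\<Sum>x\<in>V. p x y) = 1) \<and> (\<forall>x\<in>V. (\<Sum>y\<in>V. p x y) = 1)"

text \<open>A correlation is identified with its matrix of transition coefficients, which determines a
  channel between diagonal algebras.\<close>

definition local_bicorrelation ::
  "'a set \<Rightarrow> 'b set \<Rightarrow> (('a \<times> 'b) cmat \<Rightarrow> ('a \<times> 'b) cmat) \<Rightarrow> bool" where
  "local_bicorrelation V W \<Gamma> \<longleftrightarrow>
     channel (V \<times> W) (V \<times> W) \<Gamma> \<and>
     (\<exists>(n::nat) (c :: nat \<Rightarrow> real) p1 p2.
        (\<forall>k<n. 0 \<le> c k) \<and> (\<Sum>k<n. c k) = 1 \<and>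
        (\<forall>k<n. bistochastic V (p1 k) \<and> bistochastic W (p2 k)) \<and>
        (\<forall>v1\<in>V. \<forall>w2\<in>W. \<forall>v2\<in>V. \<forall>w1\<in>W.
           channel_prob \<Gamma> (v1, w2) (v2, w1) =
             of_real (\<Sum>k<n. c k * (p1 k v1 v2 * p2 k w2 w1))))"

definition fits ::
  "'v set \<Rightarrow> 'w set \<Rightarrow> ('v \<times> 'w) set \<Rightarrow> 'x set \<Rightarrow> 'y set \<Rightarrow> ('x \<times> 'y) set \<Rightarrow>
   (('x \<times> 'w) cmat \<Rightarrow> ('v \<times> 'y) cmat) \<Rightarrow> bool" where
  "fits V1 W1 E1 V2 W2 E2 \<Gamma> \<longleftrightarrow>
     (\<forall>v1\<in>V1. \<forall>w2\<in>W2. \<forall>v2\<in>V2. \<forall>w1\<in>W1.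
        channel_prob \<Gamma> (v1, w2) (v2, w1) \<noteq> 0 \<longrightarrow> ((v1, w1) \<in> E1 \<longleftrightarrow> (v2, w2) \<in> E2))"

definition loc_hom ::
  "'v set \<Rightarrow> 'w set \<Rightarrow> ('v \<times> 'w) set \<Rightarrow> 'x set \<Rightarrow> 'y set \<Rightarrow> ('x \<times> 'y) set \<Rightarrow> bool" where
  "loc_hom V1 W1 E1 V2 W2 E2 \<longleftrightarrow>
     (\<exists>\<Gamma>. local_correlation V2 W1 V1 W2 \<Gamma> \<and> fits V1 W1 E1 V2 W2 E2 \<Gamma>)"

definition loc_iso ::
  "'v set \<Rightarrow> 'w set \<Rightarrow> ('v \<times> 'w) set \<Rightarrow> ('v \<times> 'w) set \<Rightarrow> bool" where
  "loc_iso V W E1 E2 \<longleftrightarrow>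
     (\<exists>\<Gamma>. local_bicorrelation V W \<Gamma> \<and> fits V W E1 V W E2 \<Gamma>)"

end

theory Submission
  imports Defs
begin

text \<open>The support of a convex combination of products of stochastic matrices contains the support of
  every term with nonzero weight, so one may work with a single product \<open>p(v1|v2) q(w2|w1)\<close>. Choosing a point in the
  support of each column of \<open>p\<close> and \<open>q\<close> yields the maps \<open>f\<close> and \<open>g\<close> of a homomorphism. In the
  bistochastic case no Birkhoff--von Neumann decomposition is needed: fitting forces all the
  vertices in the support of a column of \<open>p\<close> to lie in the same edges, and double counting the mass
  of \<open>p\<close> shows that corresponding classes of such twins have equal size, so that \<open>f\<close> may be an
  arbitrary bijection between them; likewise for \<open>q\<close> and \<open>g\<close>. Conversely, maps \<open>f\<close> and \<open>g\<close> define
  deterministic channels.\<close>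

section \<open>Transition coefficients of channels\<close>

lemma nonneg_Reals_sum_I:
  fixes f :: "'a \<Rightarrow> complex"
  shows "(\<And>x. x \<in> A \<Longrightarrow> f x \<in> \<real>\<^sub>\<ge>\<^sub>0) \<Longrightarrow> sum f A \<in> \<real>\<^sub>\<ge>\<^sub>0"
  by (induction A rule: infinite_finite_induct) auto

lemma diag_unit_in_diag_alg: "v \<in> V \<Longrightarrow> diag_unit v \<in> diag_alg V"
  by (auto simp: diag_alg_def diag_unit_def)

text \<open>Evaluating the quadratic form at the basis vector of \<open>w\<close> isolates this
  entry.\<close>

lemma pos_semidef_diagonal_entry:
  assumes "pos_semidef W A" "finite W" "w \<in> W"
  shows "A w w \<in> \<real>\<^sub>\<ge>\<^sub>0"
proof -
  let ?x = "\<lambda>i. if i = w then 1 else 0 :: complex"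
  have "(\<Sum>i\<in>W. \<Sum>j\<in>W. cnj (?x i) * A i j * ?x j) = (\<Sum>i\<in>W. if i = w then A w w else 0)"
    using assms(2,3) by (intro sum.cong) (auto simp: if_distrib cong: if_cong)
  also have "\<dots> = A w w"
    using assms(2,3) by simp
  finally show ?thesis
    using assms(1)[unfolded pos_semidef_def, THEN spec, of ?x] by (simp only:)
qed

text \<open>The off-diagonal terms vanish, so the quadratic form is a combination of the squared
  moduli \<open>(cmod (x i))\<^sup>2\<close> with nonnegative coefficients.\<close>

lemma pos_semidef_diag:
  assumes "A \<in> diag_alg W" "finite W" "\<And>w. w \<in> W \<Longrightarrow> A w w \<in> \<real>\<^sub>\<ge>\<^sub>0"
  shows "pos_semidef W A"
  unfolding pos_semidef_def
proof
  fix x :: "'a \<Rightarrow> complex"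
  have "(\<Sum>i\<in>W. \<Sum>j\<in>W. cnj (x i) * A i j * x j) = (\<Sum>i\<in>W. A i i * of_real ((cmod (x i))\<^sup>2))"
  proof (intro sum.cong refl)
    fix i assume "i \<in> W"
    have "(\<Sum>j\<in>W. cnj (x i) * A i j * x j) = (\<Sum>j\<in>W. if j = i then cnj (x i) * A i i * x i else 0)"
      using assms(1) by (intro sum.cong) (auto simp: diag_alg_def)
    then show "(\<Sum>j\<in>W. cnj (x i) * A i j * x j) = A i i * of_real ((cmod (x i))\<^sup>2)"
      using \<open>i \<in> W\<close> assms(2) by (simp only: complex_norm_square) (simp add: mult_ac)
  qed
  also have "\<dots> \<in> \<real>\<^sub>\<ge>\<^sub>0"
    using assms(3) by (intro nonneg_Reals_sum_I nonneg_Reals_mult_I) auto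
  finally show "(\<Sum>i\<in>W. \<Sum>j\<in>W. cnj (x i) * A i j * x j) \<in> \<real>\<^sub>\<ge>\<^sub>0" .
qed

text \<open>Positivity is applied to the matrix unit at \<open>v\<close>. Together with
  \<open>channel_prob_sum\<close> this makes the transition coefficients a stochastic matrix with
  columns indexed by \<open>V\<close>.\<close>

lemma channel_prob_nonneg:
  assumes "channel V W T" "finite V" "finite W" "v \<in> V" "w \<in> W"
  shows "channel_prob T w v \<in> \<real>\<^sub>\<ge>\<^sub>0"
proof -
  have "diag_unit v \<in> diag_alg V"
    using assms(4) by (rule diag_unit_in_diag_alg)
  moreover from this have "pos_semidef V (diag_unit v)"
    using assms(2) by (rule pos_semidef_diag) (simp add: diag_unit_def)
  moreover have "\<forall>A\<in>diag_alg V. pos_semidef V A \<longrightarrow> pos_semidef W (T A)"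
    using assms(1) unfolding channel_def by (elim conjE)
  ultimately have "pos_semidef W (T (diag_unit v))"
    by blast
  then show ?thesis
    unfolding channel_prob_def using assms by (intro pos_semidef_diagonal_entry)
qed

lemma channel_prob_sum:
  assumes "channel V W T" "finite V" "v \<in> V"
  shows "(\<Sum>w\<in>W. channel_prob T w v) = 1"
proof -
  have "\<forall>A\<in>diag_alg V. ctrace W (T A) = ctrace V A"
    using assms(1) unfolding channel_def by (elim conjE)
  then have "ctrace W (T (diag_unit v)) = ctrace V (diag_unit v)"
    using diag_unit_in_diag_alg[OF assms(3)] by (rule bspec)
  also have "\<dots> = 1"
    using assms(2,3) by (simp add: ctrace_def diag_unit_def)
  finally show ?thesis
    by (simp add: ctrace_def channel_prob_def)
qed

lemma channel_prob_support:
  assumes "channel V W T" "finite V" "v \<in> V"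
  obtains w where "w \<in> W" "channel_prob T w v \<noteq> 0"
  using channel_prob_sum[OF assms] by (metis sum.neutral zero_neq_one)

text \<open>At the matrix unit of \<open>(v, w)\<close> only one summand of
  \<open>tensor_map\<close> survives.\<close>

lemma channel_prob_tensor_map:
  assumes "finite V" "finite W" "v \<in> V" "w \<in> W"
  shows "channel_prob (tensor_map V W \<Phi> \<Psi>) (a, b) (v, w) = channel_prob \<Phi> a v * channel_prob \<Psi> b w"
proof -
  have "channel_prob (tensor_map V W \<Phi> \<Psi>) (a, b) (v, w) =
      (\<Sum>q\<in>V \<times> W. if q = (v, w) then channel_prob \<Phi> a v * channel_prob \<Psi> b w else 0)"
    unfolding channel_prob_def tensor_map_def
    by (intro sum.cong) (simp_all add: diag_unit_def[of "(v, w)"] kron_def split: prod.split)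
  then show ?thesis
    using assms by simp
qed

section \<open>Deterministic channels\<close>

text \<open>The push-forward along \<open>f\<close> of the diagonal, seen as a complex measure on
  \<open>V\<close>: all mass at \<open>v\<close> moves to \<open>f v\<close>.\<close>

definition det_channel :: "'a set \<Rightarrow> ('a \<Rightarrow> 'b) \<Rightarrow> 'a cmat \<Rightarrow> 'b cmat" where
  "det_channel V f A = (\<lambda>i j. if i = j then \<Sum>v\<in>{v\<in>V. f v = i}. A v v else 0)"

lemma channel_det_channel:
  assumes "finite V" "finite W" "f \<in> V \<rightarrow> W"
  shows "channel V W (det_channel V f)"
proof -
  have diag: "det_channel V f A \<in> diag_alg W" for A
  proof -
    have "i \<in> W \<and> j = i" if nz: "det_channel V f A i j \<noteq> 0" for i j
    proof -
      have "i = j" and "(\<Sum>v\<in>{v\<in>V. f v = i}. A v v) \<noteq> 0"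
        using nz by (simp_all add: det_channel_def split: if_splits)
      moreover from this(2) obtain v where "v \<in> {v\<in>V. f v = i}"
        by (rule sum.not_neutral_contains_not_neutral)
      ultimately show ?thesis
        using assms(3) by auto
    qed
    then show ?thesis
      by (simp add: diag_alg_def)
  qed
  moreover have "pos_semidef W (det_channel V f A)" if "pos_semidef V A" for A
    using pos_semidef_diagonal_entry[OF that assms(1)] assms(2)
    by (intro pos_semidef_diag[OF diag]) (auto simp: det_channel_def intro: nonneg_Reals_sum_I)
  \<comment> \<open>The trace is the total mass, regrouped here over the fibres of
    \<open>f\<close>.\<close>
  moreover have "ctrace W (det_channel V f A) = ctrace V A" for A
    using sum.group[OF assms(1,2), of f "\<lambda>v. A v v"] assms(3)
    by (auto simp: ctrace_def det_channel_def)
  moreover have "det_channel V f (\<lambda>i j. A i j + B i j) =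
      (\<lambda>i j. det_channel V f A i j + det_channel V f B i j)" for A B
    by (intro ext) (simp add: det_channel_def sum.distrib)
  moreover have "det_channel V f (\<lambda>i j. c * A i j) = (\<lambda>i j. c * det_channel V f A i j)" for c A
    by (intro ext) (simp add: det_channel_def sum_distrib_left)
  ultimately show ?thesis
    by (simp add: channel_def)
qed

lemma channel_prob_det_channel:
  assumes "finite V" "v \<in> V"
  shows "channel_prob (det_channel V f) w v = (if f v = w then 1 else 0)"
proof -
  have "channel_prob (det_channel V f) w v =
      (\<Sum>u\<in>{u\<in>V. f u = w}. if u = v then 1 else 0)"
    by (simp add: channel_prob_def det_channel_def diag_unit_def)
  then show ?thesis
    using assms by simp
qed

lemma local_correlation_tensor_map:
  assumes "channel V2 V1 \<Phi>" "channel W1 W2 \<Psi>"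
  shows "local_correlation V2 W1 V1 W2 (tensor_map V2 W1 \<Phi> \<Psi>)"
  unfolding local_correlation_def
  by (rule exI[of _ 1], rule exI[of _ "\<lambda>_. 1"], rule exI[of _ "\<lambda>_. \<Phi>"], rule exI[of _ "\<lambda>_. \<Psi>"])
     (use assms in simp)

section \<open>Homomorphisms\<close>

text \<open>The map \<open>g\<close> picks for each \<open>w\<close> an index of the edge of
  \<open>E2\<close> that is the preimage of the edge at \<open>w\<close>. The resulting equivalence
  is the fitting condition at \<open>v1 = f v2\<close> and \<open>w2 = g w1\<close>.\<close>

lemma hypergraph_hom_iff:
  "(\<exists>f. hypergraph_hom V1 W1 E1 V2 W2 E2 f) \<longleftrightarrow>
     (\<exists>f\<in>V2 \<rightarrow> V1. \<exists>g\<in>W1 \<rightarrow> W2. \<forall>v\<in>V2. \<forall>w\<in>W1. (f v, w) \<in> E1 \<longleftrightarrow> (v, g w) \<in> E2)"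
  (is "?L \<longleftrightarrow> ?R")
proof
  assume ?L
  then obtain f where hom: "hypergraph_hom V1 W1 E1 V2 W2 E2 f" ..
  then have f: "f \<in> V2 \<rightarrow> V1"
    and edge: "\<forall>w\<in>W1. f -` hedge V1 E1 w \<inter> V2 \<in> hedge V2 E2 ` W2"
    by (simp_all add: hypergraph_hom_def hedges_def)
  have "\<forall>w\<in>W1. \<exists>w'. w' \<in> W2 \<and> f -` hedge V1 E1 w \<inter> V2 = hedge V2 E2 w'"
    using edge by blast
  from bchoice[OF this] obtain g
    where g: "\<forall>w\<in>W1. g w \<in> W2 \<and> f -` hedge V1 E1 w \<inter> V2 = hedge V2 E2 (g w)"
    by blast
  have "(f v, w) \<in> E1 \<longleftrightarrow> (v, g w) \<in> E2" if "v \<in> V2" "w \<in> W1" for v w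
  proof -
    have "v \<in> f -` hedge V1 E1 w \<inter> V2 \<longleftrightarrow> v \<in> hedge V2 E2 (g w)"
      using g that(2) by simp
    then show ?thesis
      using f that(1) by (auto simp: hedge_def)
  qed
  with f g show ?R
    by (intro bexI[of _ f] bexI[of _ g]) auto
next
  assume ?R
  then obtain f g where f: "f \<in> V2 \<rightarrow> V1" and g: "g \<in> W1 \<rightarrow> W2"
    and E: "\<forall>v\<in>V2. \<forall>w\<in>W1. (f v, w) \<in> E1 \<longleftrightarrow> (v, g w) \<in> E2"
    by blast
  have "f -` hedge V1 E1 w \<inter> V2 = hedge V2 E2 (g w)" if "w \<in> W1" for w
    using that f E unfolding hedge_def by auto
  with f g show ?L
    unfolding hypergraph_hom_def hedges_def by blast
qed

lemma isomorphic_hypergraphs_iff: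
  "isomorphic_hypergraphs V W E1 E2 \<longleftrightarrow>
     (\<exists>f g. bij_betw f V V \<and> bij_betw g W W \<and>
        (\<forall>v\<in>V. \<forall>w\<in>W. (f v, w) \<in> E1 \<longleftrightarrow> (v, g w) \<in> E2))"
  (is "?L \<longleftrightarrow> ?R")
proof
  assume ?L
  then obtain f g where f: "bij_betw f V V" and g: "bij_betw g W W"
    and eq: "\<forall>w\<in>W. f -` hedge V E1 w \<inter> V = hedge V E2 (g w)"
    unfolding isomorphic_hypergraphs_def hypergraph_iso_def by blast
  have "f v \<in> V" if "v \<in> V" for v
    using f that by (rule bij_betw_apply)
  then have "\<forall>v\<in>V. \<forall>w\<in>W. (f v, w) \<in> E1 \<longleftrightarrow> (v, g w) \<in> E2"
    using eq unfolding hedge_def by blast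
  with f g show ?R by blast
next
  assume ?R
  then obtain f g where f: "bij_betw f V V" and g: "bij_betw g W W"
    and E: "\<forall>v\<in>V. \<forall>w\<in>W. (f v, w) \<in> E1 \<longleftrightarrow> (v, g w) \<in> E2"
    by blast
  have f': "f \<in> V \<rightarrow> V" and g': "g \<in> W \<rightarrow> W"
    using f g by (auto intro: bij_betw_apply)
  have eq: "f -` hedge V E1 w \<inter> V = hedge V E2 (g w)" if "w \<in> W" for w
    using that f' E unfolding hedge_def by auto
  then have "hypergraph_hom V W E1 V W E2 f"
    using f' g' unfolding hypergraph_hom_def hedges_def by blast
  with f g eq show ?L
    unfolding isomorphic_hypergraphs_def hypergraph_iso_def by blast
qed

lemma loc_hom_iff_hom:
  assumes "hypergraph V1 W1 E1" "hypergraph V2 W2 E2"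
  shows "loc_hom V1 W1 E1 V2 W2 E2 \<longleftrightarrow> (\<exists>f. hypergraph_hom V1 W1 E1 V2 W2 E2 f)"
proof -
  have fin: "finite V1" "finite W1" "finite V2" "finite W2"
    using assms by (auto simp: hypergraph_def)
  show ?thesis
    unfolding hypergraph_hom_iff
  proof
    assume "loc_hom V1 W1 E1 V2 W2 E2"
    then obtain \<Gamma> n c \<Phi> \<Psi> where fits: "fits V1 W1 E1 V2 W2 E2 \<Gamma>"
      and c: "\<forall>k<n::nat. 0 \<le> (c k :: real)" "(\<Sum>k<n. c k) = 1"
      and ch: "\<forall>k<n. channel V2 V1 (\<Phi> k) \<and> channel W1 W2 (\<Psi> k)"
      and \<Gamma>: "\<forall>M\<in>diag_alg (V2 \<times> W1).
           \<Gamma> M = (\<lambda>p q. \<Sum>k<n. of_real (c k) * tensor_map V2 W1 (\<Phi> k) (\<Psi> k) M p q)"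
      unfolding loc_hom_def local_correlation_def by blast
    \<comment> \<open>The weights sum to 1, so they cannot all vanish; the term \<open>k\<close> is
      the product to work with.\<close>
    obtain k where k: "k < n" "c k \<noteq> 0"
      using c(2) by (metis lessThan_iff sum.neutral zero_neq_one)
    have "\<forall>v\<in>V2. \<exists>x. x \<in> V1 \<and> channel_prob (\<Phi> k) x v \<noteq> 0"
      using channel_prob_support[of V2 V1 "\<Phi> k"] ch k(1) fin by blast
    then obtain f where f: "\<And>v. v \<in> V2 \<Longrightarrow> f v \<in> V1 \<and> channel_prob (\<Phi> k) (f v) v \<noteq> 0"
      using bchoice by metis
    have "\<forall>w\<in>W1. \<exists>x. x \<in> W2 \<and> channel_prob (\<Psi> k) x w \<noteq> 0"
      using channel_prob_support[of W1 W2 "\<Psi> k"] ch k(1) fin by blast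
    then obtain g where g: "\<And>w. w \<in> W1 \<Longrightarrow> g w \<in> W2 \<and> channel_prob (\<Psi> k) (g w) w \<noteq> 0"
      using bchoice by metis
    have "(f v, w) \<in> E1 \<longleftrightarrow> (v, g w) \<in> E2" if v: "v \<in> V2" and w: "w \<in> W1" for v w
    proof -
      \<comment> \<open>\<open>t i\<close> is the contribution of the i-th product to the
        coefficient of \<Gamma>. These are nonnegative complex numbers and \<open>t k\<close> is
        nonzero, so there is no cancellation; this is checked on real parts, where the order is
        available.\<close>
      define t where
        "t i = of_real (c i) * (channel_prob (\<Phi> i) (f v) v * channel_prob (\<Psi> i) (g w) w)" for i
      have eq: "channel_prob \<Gamma> (f v, g w) (v, w) = (\<Sum>i<n. t i)"
      proof -
        have "diag_unit (v, w) \<in> diag_alg (V2 \<times> W1)"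
          using v w by (intro diag_unit_in_diag_alg) auto
        then have "channel_prob \<Gamma> (f v, g w) (v, w) =
            (\<Sum>i<n. of_real (c i) * channel_prob (tensor_map V2 W1 (\<Phi> i) (\<Psi> i)) (f v, g w) (v, w))"
          using \<Gamma> by (simp add: channel_prob_def)
        then show ?thesis
          by (simp add: t_def channel_prob_tensor_map[OF fin(3,2) v w])
      qed
      have t: "t i \<in> \<real>\<^sub>\<ge>\<^sub>0" if "i < n" for i
        unfolding t_def using that c(1) ch f[OF v] g[OF w] v w fin
        by (intro nonneg_Reals_mult_I channel_prob_nonneg[of V2 V1] channel_prob_nonneg[of W1 W2]) auto
      have "t k \<noteq> 0"
        using k f[OF v] g[OF w] by (simp add: t_def)
      then have "0 < Re (t k)"
        using t[OF k(1)] by (auto simp: complex_nonneg_Reals_iff complex_eq_iff)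
      moreover have "0 \<le> Re (t i)" if "i < n" for i
        using t[OF that] by (simp add: complex_nonneg_Reals_iff)
      ultimately have "0 < (\<Sum>i<n. Re (t i))"
        using k(1) by (intro sum_pos2[of _ k]) auto
      then have "channel_prob \<Gamma> (f v, g w) (v, w) \<noteq> 0"
        unfolding eq by (metis Re_sum zero_complex.simps(1) less_irrefl)
      then show ?thesis
        using f[OF v] g[OF w] v w by (intro fits[unfolded fits_def, rule_format]) auto
    qed
    then show "\<exists>f\<in>V2 \<rightarrow> V1. \<exists>g\<in>W1 \<rightarrow> W2. \<forall>v\<in>V2. \<forall>w\<in>W1. (f v, w) \<in> E1 \<longleftrightarrow> (v, g w) \<in> E2"
      using f g by (intro bexI[of _ f] bexI[of _ g]) auto
  next
    assume "\<exists>f\<in>V2 \<rightarrow> V1. \<exists>g\<in>W1 \<rightarrow> W2. \<forall>v\<in>V2. \<forall>w\<in>W1. (f v, w) \<in> E1 \<longleftrightarrow> (v, g w) \<in> E2"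
    then obtain f g where f: "f \<in> V2 \<rightarrow> V1" and g: "g \<in> W1 \<rightarrow> W2"
      and E: "\<forall>v\<in>V2. \<forall>w\<in>W1. (f v, w) \<in> E1 \<longleftrightarrow> (v, g w) \<in> E2"
      by blast
    \<comment> \<open>A single product with weight 1. Its coefficients are nonzero only at
      \<open>v1 = f v2\<close> and \<open>w2 = g w1\<close>, where fitting is exactly the assumed
      equivalence.\<close>
    let ?\<Gamma> = "tensor_map V2 W1 (det_channel V2 f) (det_channel W1 g)"
    have "local_correlation V2 W1 V1 W2 ?\<Gamma>"
      using f g fin by (intro local_correlation_tensor_map channel_det_channel)
    moreover have "fits V1 W1 E1 V2 W2 E2 ?\<Gamma>"
      using E fin unfolding fits_def
      by (auto simp: channel_prob_tensor_map channel_prob_det_channel split: if_splits)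
    ultimately show "loc_hom V1 W1 E1 V2 W2 E2"
      unfolding loc_hom_def by blast
  qed
qed

section \<open>Isomorphisms\<close>

lemma bistochastic_support_col:
  assumes "bistochastic V p" "y \<in> V"
  obtains x where "x \<in> V" "0 < p x y"
proof -
  have "\<exists>x\<in>V. p x y \<noteq> 0"
    using assms unfolding bistochastic_def by (metis sum.neutral zero_neq_one)
  then show ?thesis
    using assms that unfolding bistochastic_def by (metis less_eq_real_def)
qed

text \<open>\<open>a\<close> labels the rows and \<open>b\<close> the columns, and the support of
  \<open>p\<close> respects the labels. The mass in the block of a label \<open>L\<close> equals its
  number of rows, by row sums, and its number of columns, by column sums. The blocks are therefore
  square, and bijections between the label classes can be glued.\<close>

lemma bistochastic_block_bij:
  assumes p: "bistochastic V p" and fin: "finite V"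
    and block: "\<And>x y. x \<in> V \<Longrightarrow> y \<in> V \<Longrightarrow> 0 < p x y \<Longrightarrow> a x = b y"
  obtains f where "bij_betw f V V" "\<And>y. y \<in> V \<Longrightarrow> a (f y) = b y"
proof -
  have supp: "a x = b y" if "x \<in> V" "y \<in> V" "p x y \<noteq> 0" for x y
    using that p block[of x y] unfolding bistochastic_def by force
  have card: "card {y\<in>V. b y = L} = card {x\<in>V. a x = L}" for L
  proof -
    have "real (card {x\<in>V. a x = L}) = (\<Sum>x\<in>{x\<in>V. a x = L}. \<Sum>y\<in>V. p x y)"
      using p by (simp add: bistochastic_def)
    \<comment> \<open>Rows labelled \<open>L\<close> vanish outside the columns labelled
      \<open>L\<close>; after the swap the same fact extends the column sums back to all of
      \<open>V\<close>.\<close>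
    also have "\<dots> = (\<Sum>x\<in>{x\<in>V. a x = L}. \<Sum>y\<in>{y\<in>V. b y = L}. p x y)"
      by (rule sum.cong[OF refl], rule sum.mono_neutral_right) (use fin in \<open>auto intro: supp supp[symmetric]\<close>)
    also have "\<dots> = (\<Sum>y\<in>{y\<in>V. b y = L}. \<Sum>x\<in>{x\<in>V. a x = L}. p x y)"
      by (rule sum.swap)
    also have "\<dots> = (\<Sum>y\<in>{y\<in>V. b y = L}. \<Sum>x\<in>V. p x y)"
      by (rule sum.cong[OF refl], rule sum.mono_neutral_left) (use fin in \<open>auto intro: supp supp[symmetric]\<close>)
    also have "\<dots> = real (card {y\<in>V. b y = L})"
      using p by (simp add: bistochastic_def)
    finally show ?thesis by simp
  qed
  have "\<forall>L. \<exists>h. bij_betw h {y\<in>V. b y = L} {x\<in>V. a x = L}"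
    using card fin by (intro allI finite_same_card_bij) auto
  then obtain h where h: "\<And>L. bij_betw (h L) {y\<in>V. b y = L} {x\<in>V. a x = L}"
    by metis
  \<comment> \<open>The label of \<open>y\<close> selects the bijection to apply. Equal values of
    \<open>f\<close> carry equal labels, so injectivity reduces to that of a single
    \<open>h L\<close>; finiteness of \<open>V\<close> then gives surjectivity.\<close>
  define f where "f y = h (b y) y" for y
  have f: "f y \<in> V \<and> a (f y) = b y" if "y \<in> V" for y
    using bij_betw_apply[OF h[of "b y"], of y] that by (simp add: f_def)
  have "inj_on f V"
  proof (rule inj_onI)
    fix y z assume yz: "y \<in> V" "z \<in> V" "f y = f z"
    then have "b y = b z"
      using f by metis
    with yz show "y = z"
      using bij_betw_imp_inj_on[OF h[of "b z"]] by (auto simp: f_def inj_on_def)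
  qed
  moreover have "f ` V \<subseteq> V"
    using f by blast
  ultimately have "bij_betw f V V"
    using fin by (simp add: bij_betw_def endo_inj_surj)
  with f show ?thesis
    using that by blast
qed

text \<open>This is the permutation matrix of \<open>f\<close>; the row sums are obtained by
  reindexing along \<open>f\<close>.\<close>

lemma bistochastic_bij:
  assumes "bij_betw f V V" "finite V"
  shows "bistochastic V (\<lambda>x y. if x = f y then 1 else 0)"
proof -
  have "(\<Sum>y\<in>V. if x = f y then 1 else 0 :: real) = 1" if "x \<in> V" for x
    using sum.reindex_bij_betw[OF assms(1), of "\<lambda>z. if x = z then 1 else 0 :: real"] that assms(2)
    by simp
  moreover have "f y \<in> V" if "y \<in> V" for y
    using assms(1) that by (rule bij_betw_apply)
  ultimately show ?thesis
    using assms(2) by (simp add: bistochastic_def)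
qed

lemma loc_iso_imp_isomorphic:
  assumes fin: "finite V" "finite W" and "loc_iso V W E1 E2"
  shows "isomorphic_hypergraphs V W E1 E2"
proof -
  obtain \<Gamma> n c p1 p2 where fits: "fits V W E1 V W E2 \<Gamma>"
    and c: "\<forall>k<n::nat. 0 \<le> (c k :: real)" "(\<Sum>k<n. c k) = 1"
    and bs: "\<forall>k<n. bistochastic V (p1 k) \<and> bistochastic W (p2 k)"
    and \<Gamma>: "\<forall>v1\<in>V. \<forall>w2\<in>W. \<forall>v2\<in>V. \<forall>w1\<in>W. channel_prob \<Gamma> (v1, w2) (v2, w1) =
        of_real (\<Sum>k<n. c k * (p1 k v1 v2 * p2 k w2 w1))"
    using assms(3) unfolding loc_iso_def local_bicorrelation_def by blast
  obtain k where k: "k < n" "c k \<noteq> 0"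
    using c(2) by (metis lessThan_iff sum.neutral zero_neq_one)
  define p q where "p = p1 k" and "q = p2 k"
  have p: "bistochastic V p" and q: "bistochastic W q"
    using bs k by (auto simp: p_def q_def)
  have E: "(x, w1) \<in> E1 \<longleftrightarrow> (y, w2) \<in> E2"
    if V: "x \<in> V" "y \<in> V" and W: "w1 \<in> W" "w2 \<in> W" and pos: "0 < p x y" "0 < q w2 w1"
    for x y w1 w2
  proof -
    have "0 < c k * (p1 k x y * p2 k w2 w1)"
      using k c(1) pos by (simp add: p_def q_def less_le)
    moreover have "0 \<le> c i * (p1 i x y * p2 i w2 w1)" if "i < n" for i
      using that c(1) bs V W by (simp add: bistochastic_def)
    ultimately have "0 < (\<Sum>i<n. c i * (p1 i x y * p2 i w2 w1))"
      using k(1) by (intro sum_pos2[of _ k]) auto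
    moreover have "channel_prob \<Gamma> (x, w2) (y, w1) = of_real (\<Sum>i<n. c i * (p1 i x y * p2 i w2 w1))"
      using \<Gamma> V W by blast
    ultimately have "channel_prob \<Gamma> (x, w2) (y, w1) \<noteq> 0"
      by (simp only: of_real_eq_0_iff less_imp_neq[symmetric] not_False_eq_True)
    then show ?thesis
      by (rule fits[unfolded fits_def, rule_format, OF V(1) W(2) V(2) W(1)])
  qed
  \<comment> \<open>Labels for the block lemma. A vertex \<open>x\<close> is labelled by the indices
    of the edges of \<open>E1\<close> containing it; \<open>?b y\<close> expresses the label common
    to all \<open>x\<close> in the support of column \<open>y\<close> of \<open>p\<close> without
    mentioning \<open>x\<close>. Dually, \<open>?d w1\<close> is the edge of \<open>E2\<close>
    common to all \<open>w2\<close> in the support of column \<open>w1\<close> of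
    \<open>q\<close>.\<close>
  let ?b = "\<lambda>y. {w1\<in>W. \<exists>w2\<in>W. 0 < q w2 w1 \<and> (y, w2) \<in> E2}"
  let ?d = "\<lambda>w1. {y\<in>V. \<exists>x\<in>V. 0 < p x y \<and> (x, w1) \<in> E1}"
  have "{w1\<in>W. (x, w1) \<in> E1} = ?b y" if "x \<in> V" "y \<in> V" "0 < p x y" for x y
  proof (intro Collect_cong conj_cong refl)
    fix w1 assume w1: "w1 \<in> W"
    show "(x, w1) \<in> E1 \<longleftrightarrow> (\<exists>w2\<in>W. 0 < q w2 w1 \<and> (y, w2) \<in> E2)"
      \<comment> \<open>Column \<open>w1\<close> of \<open>q\<close> has some \<open>w2\<close> in
        its support, and \<open>E\<close> carries membership across for every such
        \<open>w2\<close>.\<close>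
      using E[OF that(1,2) w1 _ that(3)] bistochastic_support_col[OF q w1] by metis
  qed
  from bistochastic_block_bij[OF p fin(1), of "\<lambda>x. {w1\<in>W. (x, w1) \<in> E1}" ?b, OF this]
  obtain f where f: "bij_betw f V V" "\<And>y. y \<in> V \<Longrightarrow> {w1\<in>W. (f y, w1) \<in> E1} = ?b y"
    by blast
  have col: "{y\<in>V. (y, w2) \<in> E2} = ?d w1" if "w2 \<in> W" "w1 \<in> W" "0 < q w2 w1" for w2 w1
  proof (intro Collect_cong conj_cong refl)
    fix y assume y: "y \<in> V"
    show "(y, w2) \<in> E2 \<longleftrightarrow> (\<exists>x\<in>V. 0 < p x y \<and> (x, w1) \<in> E1)"
      using E[OF _ y that(2,1) _ that(3)] bistochastic_support_col[OF p y] by metis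
  qed
  from bistochastic_block_bij[OF q fin(2), of "\<lambda>w2. {y\<in>V. (y, w2) \<in> E2}" ?d, OF this]
  obtain g where g: "bij_betw g W W" "\<And>w1. w1 \<in> W \<Longrightarrow> {y\<in>V. (y, g w1) \<in> E2} = ?d w1"
    by blast
  have "(f y, w1) \<in> E1 \<longleftrightarrow> (y, g w1) \<in> E2" if y: "y \<in> V" and w1: "w1 \<in> W" for y w1
  proof -
    \<comment> \<open>\<open>f\<close> and \<open>g\<close> were chosen independently, and
      \<open>g w1\<close> may lie outside the support of column \<open>w1\<close> of
      \<open>q\<close>. It still indexes the same edge of \<open>E2\<close> as every
      \<open>w2\<close> in that support, which links the two maps.\<close>
    have twin: "(y, w2) \<in> E2 \<longleftrightarrow> (y, g w1) \<in> E2" if "w2 \<in> W" "0 < q w2 w1" for w2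
      using col[OF that(1) w1 that(2)] g(2)[OF w1] y by blast
    have "(f y, w1) \<in> E1 \<longleftrightarrow> (\<exists>w2\<in>W. 0 < q w2 w1 \<and> (y, w2) \<in> E2)"
      using f(2)[OF y] w1 by blast
    also have "\<dots> \<longleftrightarrow> (y, g w1) \<in> E2"
      using twin bistochastic_support_col[OF q w1] by metis
    finally show ?thesis .
  qed
  with f(1) g(1) show ?thesis
    unfolding isomorphic_hypergraphs_iff by blast
qed

lemma isomorphic_imp_loc_iso:
  assumes fin: "finite V" "finite W" and "isomorphic_hypergraphs V W E1 E2"
  shows "loc_iso V W E1 E2"
proof -
  obtain f g where f: "bij_betw f V V" and g: "bij_betw g W W"
    and E: "\<forall>v\<in>V. \<forall>w\<in>W. (f v, w) \<in> E1 \<longleftrightarrow> (v, g w) \<in> E2"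
    using assms(3) unfolding isomorphic_hypergraphs_iff by blast
  \<comment> \<open>The deterministic channel of the product map on \<open>V \<times> W\<close> is a
    channel by \<open>channel_det_channel\<close>, and its coefficients factor into the permutation
    matrices \<open>?p\<close> and \<open>?q\<close>.\<close>
  let ?\<Gamma> = "det_channel (V \<times> W) (map_prod f g)"
  let ?p = "\<lambda>x y. if x = f y then 1 else 0 :: real"
  let ?q = "\<lambda>x y. if x = g y then 1 else 0 :: real"
  have prob: "channel_prob ?\<Gamma> (v1, w2) (v2, w1) = (if f v2 = v1 \<and> g w1 = w2 then 1 else 0)"
    if "v2 \<in> V" "w1 \<in> W" for v1 v2 w1 w2
    using that fin by (simp add: channel_prob_det_channel)
  have "channel (V \<times> W) (V \<times> W) ?\<Gamma>"
    using f g fin by (intro channel_det_channel) (auto intro: bij_betw_apply)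
  moreover have "\<exists>(n::nat) (c :: nat \<Rightarrow> real) p1 p2.
        (\<forall>k<n. 0 \<le> c k) \<and> (\<Sum>k<n. c k) = 1 \<and>
        (\<forall>k<n. bistochastic V (p1 k) \<and> bistochastic W (p2 k)) \<and>
        (\<forall>v1\<in>V. \<forall>w2\<in>W. \<forall>v2\<in>V. \<forall>w1\<in>W.
           channel_prob ?\<Gamma> (v1, w2) (v2, w1) =
             of_real (\<Sum>k<n. c k * (p1 k v1 v2 * p2 k w2 w1)))"
    by (rule exI[of _ 1], rule exI[of _ "\<lambda>_. 1"], rule exI[of _ "\<lambda>_. ?p"], rule exI[of _ "\<lambda>_. ?q"])
       (use bistochastic_bij[OF f fin(1)] bistochastic_bij[OF g fin(2)] in \<open>auto simp: prob\<close>)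
  ultimately have "local_bicorrelation V W ?\<Gamma>"
    unfolding local_bicorrelation_def by blast
  moreover have "fits V W E1 V W E2 ?\<Gamma>"
    using E unfolding fits_def by (auto simp: prob split: if_splits)
  ultimately show ?thesis
    unfolding loc_iso_def by blast
qed

theorem proposition4p5:
  fixes V1 V2 :: "'v set" and W1 W2 :: "'w set"
    and E1 E2 :: "('v \<times> 'w) set"
  assumes "hypergraph V1 W1 E1" and "hypergraph V2 W2 E2"
  shows "(loc_hom V1 W1 E1 V2 W2 E2 \<longleftrightarrow> (\<exists>f. hypergraph_hom V1 W1 E1 V2 W2 E2 f)) \<and>
    (V1 = V2 \<and> W1 = W2 \<longrightarrow>
      (loc_iso V1 W1 E1 E2 \<longleftrightarrow> isomorphic_hypergraphs V1 W1 E1 E2))"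
proof (rule conjI[OF loc_hom_iff_hom[OF assms]], rule impI)
  have fin: "finite V1" "finite W1"
    using assms(1) by (simp_all add: hypergraph_def)
  show "loc_iso V1 W1 E1 E2 \<longleftrightarrow> isomorphic_hypergraphs V1 W1 E1 E2"
    using loc_iso_imp_isomorphic[OF fin] isomorphic_imp_loc_iso[OF fin] by (rule iffI)
qed

end
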